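(* Let $\mathcal{Q}$ be a family of measures describing an uncertain location parameter: $\mathcal{Q}$ is parameterized by $\mu_Q=E_Q[X]\in\mathbb{R}$, and under $Q\in\mathcal{Q}$ the random variables $X,\{X_n\}_{n=1}^N$ are iid with density $x\mapsto\exp(-\Psi(x-\mu_Q))$. Suppose $\Psi$ has monotone increasing derivative $\psi$ (which may be discontinuous) and $$-\infty\le\lim_{x\to-\infty}\psi(x)<0<\lim_{x\to+\infty}\psi(x)\le\infty.$$ The MLE parameter (assuming it exists) is given by the solution $\mu$ to $\sum_n\psi(X_n-\mu)=0$. The following are equivalent. (i) The MLE parameter has a breakdown point above zero (that is, some fraction of the observations can be made arbitrarily large or small without making the MLE arbitrarily large or small). (ii) The MLE parameter is weakly continuous with respect to the empirical cdf of observations, for any empirical cdf where the MLE parameter is uniquely defined. (iii) $\psi$ is bounded. (iv) For any fixed $k>0$ and $N$, for all $\beta\in\mathbb{R}$ sufficiently large in absolute value, $\mathcal{E}^{k,1}_{\mathcal{Q}|\mathbf{x}_N}(\beta\xi)\notin\mathbb{R}$, where $\xi$ is an iid copy of the observations.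
   Context: Write $\mathbf{x}_N=(X_1,\dots,X_N)$ and $L(Q|\mathbf{x}_N)=\prod_{n=1}^N\exp(-\Psi(X_n-\mu_Q))$. Divergence: $\alpha_{\mathcal{Q}|\mathbf{x}_N}(Q)=-\log L(Q|\mathbf{x}_N)+\sup_{\tilde Q\in\mathcal{Q}}\log L(\tilde Q|\mathbf{x}_N)$. DR-expectation: $\mathcal{E}^{k,1}_{\mathcal{Q}|\mathbf{x}_N}(\eta)=\sup_{Q\in\mathcal{Q}}\{E_Q[\eta|\mathbf{x}_N]-\frac1k\alpha_{\mathcal{Q}|\mathbf{x}_N}(Q)\}$; for $\eta=\beta\xi$ with $\xi$ an iid copy of the observations, $E_Q[\eta|\mathbf{x}_N]=\beta\mu_Q$. When $\psi$ is discontinuous, "solution to $\sum_n\psi(X_n-\mu)=0$" means that either equality holds or the left and right limits in $\mu$ of the left-hand side differ in sign at $\mu$; i.e. $\mu$ minimizes $\sum_n\Psi(X_n-\mu)$. "Monotone increasing" means nondecreasing. Meaning of (i): there is $\delta>0$ such that, for every sample size $N$, every sample $(x_1,\dots,x_N)$, and every set $M\subseteq\{1,\dots,N\}$ with $|M|<\delta N$, the MLE parameters of the samples obtained by replacing $x_i$, $i\in M$, by arbitrary reals $y_i$ remain bounded uniformly in $(y_i)_{i\in M}$. Meaning of (ii): regarding the MLE parameter as a function of the empirical cdf of the sample, if $F_0$ is an empirical cdf for which the MLE parameter $\mu_0$ is unique, and $F_j$ are empirical cdfs (of any sample sizes) converging weakly to $F_0$ with MLE parameters $\mu_j$, then $\mu_j\to\mu_0$.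 In (iv), the sample $\mathbf{x}_N$ is fixed and the threshold on $|\beta|$ may depend on $k$, $N$ and $\mathbf{x}_N$. *)

theory Defs
  imports "HOL-Probability.Probability"
begin

text \<open>
  Throughout, \<open>X :: nat \<Rightarrow> 'w \<Rightarrow> real\<close> is one iid sequence: \<open>X 0\<close> is the generic copy
  (used both as \<open>X\<close> and as the unobserved iid copy \<open>\<xi>\<close>), and \<open>X 1, \<dots>, X N\<close> are the observations.
  A sample of size \<open>N\<close> is a function \<open>x :: nat \<Rightarrow> real\<close> of which only the values on \<open>{1..N}\<close> are used.
\<close>

text \<open>
  A monotone function that is a derivative at every point is continuous (Darboux). A discontinuous
  \<open>\<psi>\<close> is therefore the derivative of the continuous function \<open>\<Psi>\<close> at the continuity points
  of \<open>\<psi>\<close>, i.e. off a countable set; by monotonicity, at a jump \<open>\<psi>\<close> takes some value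
  between the left and the right derivative of \<open>\<Psi>\<close>.
\<close>

definition monotone_derivative :: "(real \<Rightarrow> real) \<Rightarrow> (real \<Rightarrow> real) \<Rightarrow> bool" where
  "monotone_derivative \<Psi> \<psi> \<longleftrightarrow>
     mono \<psi> \<and> continuous_on UNIV \<Psi> \<and>
     (\<forall>x. isCont \<psi> x \<longrightarrow> (\<Psi> has_real_derivative \<psi> x) (at x))"

definition loc :: "(nat \<Rightarrow> 'w \<Rightarrow> real) \<Rightarrow> 'w measure \<Rightarrow> real" where
  "loc X Q = integral\<^sup>L Q (X 0)"

definition location_family ::
  "(real \<Rightarrow> real) \<Rightarrow> (nat \<Rightarrow> 'w \<Rightarrow> real) \<Rightarrow> 'w measure set \<Rightarrow> bool" where
  "location_family \<Psi> X \<Q> \<longleftrightarrow>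
     bij_betw (loc X) \<Q> UNIV \<and>
     (\<forall>Q\<in>\<Q>. prob_space Q \<and> integrable Q (X 0) \<and>
        prob_space.indep_vars Q (\<lambda>_. borel) X UNIV \<and>
        (\<forall>n. distributed Q lborel (X n) (\<lambda>x. ennreal (exp (- \<Psi> (x - loc X Q))))))"

text \<open>Under \<open>Q\<close>, the joint density of the variables \<open>X n\<close>, \<open>n \<in> I\<close>, at the point \<open>v\<close>.\<close>

definition joint_density ::
  "(real \<Rightarrow> real) \<Rightarrow> (nat \<Rightarrow> 'w \<Rightarrow> real) \<Rightarrow> 'w measure \<Rightarrow> nat set \<Rightarrow> (nat \<Rightarrow> real) \<Rightarrow> real" where
  "joint_density \<Psi> X Q I v = (\<Prod>n\<in>I. exp (- \<Psi> (v n - loc X Q)))"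

definition likelihood ::
  "(real \<Rightarrow> real) \<Rightarrow> (nat \<Rightarrow> 'w \<Rightarrow> real) \<Rightarrow> nat \<Rightarrow> (nat \<Rightarrow> real) \<Rightarrow> 'w measure \<Rightarrow> real" where
  "likelihood \<Psi> X N x Q = joint_density \<Psi> X Q {1..N} x"

definition divergence ::
  "(real \<Rightarrow> real) \<Rightarrow> (nat \<Rightarrow> 'w \<Rightarrow> real) \<Rightarrow> 'w measure set \<Rightarrow> nat \<Rightarrow> (nat \<Rightarrow> real) \<Rightarrow> 'w measure \<Rightarrow> ereal" where
  "divergence \<Psi> X \<Q> N x Q =
     - ereal (ln (likelihood \<Psi> X N x Q)) + (SUP Q'\<in>\<Q>. ereal (ln (likelihood \<Psi> X N x Q')))"

text \<open>
  \<open>E\<^sub>Q[h(\<xi>) | x\<^sub>N]\<close> for \<open>\<xi> = X 0\<close>, in the version given by the conditional density of \<open>X 0\<close> given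
  \<open>X 1 = x 1, \<dots>, X N = x N\<close>. This version is defined at every sample \<open>x\<close>, which is needed because
  the supremum below is over uncountably many \<open>Q\<close> at a fixed \<open>x\<close>.
\<close>

definition cond_mean ::
  "(real \<Rightarrow> real) \<Rightarrow> (nat \<Rightarrow> 'w \<Rightarrow> real) \<Rightarrow> nat \<Rightarrow> (nat \<Rightarrow> real) \<Rightarrow> 'w measure \<Rightarrow> (real \<Rightarrow> real) \<Rightarrow> real" where
  "cond_mean \<Psi> X N x Q h =
     (\<integral>y. h y * joint_density \<Psi> X Q {0..N} (x(0 := y)) \<partial>lborel) /
     (\<integral>y. joint_density \<Psi> X Q {0..N} (x(0 := y)) \<partial>lborel)"

text \<open>The DR-expectation of \<open>h(\<xi>)\<close> with uncertainty parameter \<open>k\<close> and exponent 1.\<close>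

definition DR_expectation ::
  "(real \<Rightarrow> real) \<Rightarrow> (nat \<Rightarrow> 'w \<Rightarrow> real) \<Rightarrow> 'w measure set \<Rightarrow> real \<Rightarrow> nat \<Rightarrow> (nat \<Rightarrow> real) \<Rightarrow> (real \<Rightarrow> real) \<Rightarrow> ereal" where
  "DR_expectation \<Psi> X \<Q> k N x h =
     (SUP Q\<in>\<Q>. ereal (cond_mean \<Psi> X N x Q h) - ereal (1 / k) * divergence \<Psi> X \<Q> N x Q)"

definition is_mle ::
  "(real \<Rightarrow> real) \<Rightarrow> (nat \<Rightarrow> 'w \<Rightarrow> real) \<Rightarrow> 'w measure set \<Rightarrow> nat \<Rightarrow> (nat \<Rightarrow> real) \<Rightarrow> real \<Rightarrow> bool" where
  "is_mle \<Psi> X \<Q> N x m \<longleftrightarrow>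
     (\<exists>Q\<in>\<Q>. loc X Q = m \<and> (\<forall>Q'\<in>\<Q>. likelihood \<Psi> X N x Q' \<le> likelihood \<Psi> X N x Q))"

text \<open>
  Solutions of \<open>\<Sum>\<^sub>n \<psi>(x n - m) = 0\<close> in the sense appropriate for discontinuous \<open>\<psi>\<close>. A one-sided
  limit may itself be 0, so ``differ in sign'' is read as having different \<open>sgn\<close>.
\<close>

definition solves_score_equation :: "(real \<Rightarrow> real) \<Rightarrow> nat \<Rightarrow> (nat \<Rightarrow> real) \<Rightarrow> real \<Rightarrow> bool" where
  "solves_score_equation \<psi> N x m \<longleftrightarrow>
     (\<Sum>n\<in>{1..N}. \<psi> (x n - m)) = 0 \<or>
     (\<exists>a b. ((\<lambda>t. \<Sum>n\<in>{1..N}. \<psi> (x n - t)) \<longlongrightarrow> a) (at_left m) \<and>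
            ((\<lambda>t. \<Sum>n\<in>{1..N}. \<psi> (x n - t)) \<longlongrightarrow> b) (at_right m) \<and> sgn a \<noteq> sgn b)"

text \<open>The bound \<open>B\<close> may depend on the sample and on the set of replaced indices.\<close>

definition positive_breakdown_point ::
  "(real \<Rightarrow> real) \<Rightarrow> (nat \<Rightarrow> 'w \<Rightarrow> real) \<Rightarrow> 'w measure set \<Rightarrow> bool" where
  "positive_breakdown_point \<Psi> X \<Q> \<longleftrightarrow>
     (\<exists>\<delta>>0. \<forall>N\<ge>1. \<forall>x. \<forall>M\<subseteq>{1..N}. real (card M) < \<delta> * real N \<longrightarrow>
        (\<exists>B. \<forall>y m. is_mle \<Psi> X \<Q> N (\<lambda>n. if n \<in> M then y n else x n) m \<longrightarrow> \<bar>m\<bar> \<le> B))"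

definition empirical_cdf :: "nat \<Rightarrow> (nat \<Rightarrow> real) \<Rightarrow> real \<Rightarrow> real" where
  "empirical_cdf N x t = real (card {n\<in>{1..N}. x n \<le> t}) / real N"

definition mle_weakly_continuous ::
  "(real \<Rightarrow> real) \<Rightarrow> (nat \<Rightarrow> 'w \<Rightarrow> real) \<Rightarrow> 'w measure set \<Rightarrow> bool" where
  "mle_weakly_continuous \<Psi> X \<Q> \<longleftrightarrow>
     (\<forall>N\<^sub>0 x\<^sub>0 m\<^sub>0 N x m.
        N\<^sub>0 \<ge> 1 \<and> is_mle \<Psi> X \<Q> N\<^sub>0 x\<^sub>0 m\<^sub>0 \<and> (\<forall>m'. is_mle \<Psi> X \<Q> N\<^sub>0 x\<^sub>0 m' \<longrightarrow> m' = m\<^sub>0) \<and>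
        (\<forall>j. N j \<ge> 1 \<and> is_mle \<Psi> X \<Q> (N j) (x j) (m j)) \<and>
        weak_conv (\<lambda>j. empirical_cdf (N j) (x j)) (empirical_cdf N\<^sub>0 x\<^sub>0)
        \<longrightarrow> m \<longlonglongrightarrow> m\<^sub>0)"

definition DR_expectation_infinite_for_large ::
  "(real \<Rightarrow> real) \<Rightarrow> (nat \<Rightarrow> 'w \<Rightarrow> real) \<Rightarrow> 'w measure set \<Rightarrow> bool" where
  "DR_expectation_infinite_for_large \<Psi> X \<Q> \<longleftrightarrow>
     (\<forall>k>0. \<forall>N\<ge>1. \<forall>x. \<exists>B. \<forall>\<beta>. \<bar>\<beta>\<bar> \<ge> B \<longrightarrow>
        DR_expectation \<Psi> X \<Q> k N x (\<lambda>y. \<beta> * y) \<notin> range ereal)"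

end

theory Submission
  imports Defs
begin

text \<open>
  The negative log-likelihood \<open>L(\<mu>) = \<Sum>\<^sub>n \<Psi>(x\<^sub>n - \<mu>)\<close> is convex and \<open>- \<Sum>\<^sub>n \<psi>(x\<^sub>n - \<mu>)\<close> is a subgradient
  of it, so minimizers are located by the sign of the score. If \<open>|\<psi>| \<le> C\<close>, a small fraction of the
  observations cannot overturn the sign that the others give to the score far out, and score averages
  are continuous under weak convergence up to a small translation. If \<open>\<psi>\<close> is unbounded, a single
  observation can move the minimizer arbitrarily far; adding it to many copies of a two-point sample
  with a unique minimizer changes the empirical cdf by \<open>O(1/N)\<close>. Finally, up to a constant the
  DR-expectation of \<open>\<beta>\<xi>\<close> is \<open>sup\<^sub>\<mu> (\<beta>\<mu> - L(\<mu>)/k)\<close>, the convex conjugate of \<open>L/k\<close>, which is finite on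
  an unbounded set of \<open>\<beta>\<close> exactly when \<open>L\<close> grows superlinearly in some direction, i.e. when \<open>\<psi>\<close> is
  unbounded.
\<close>

section \<open>Monotonicity and subgradients from a derivative off a countable set\<close>

text \<open>If \<open>f b < f a\<close>, some level \<open>y\<close> strictly in between is missed
  by the countable image of \<open>E\<close>. At the last point of \<open>{a..b}\<close> where
  \<open>f\<close> is at least \<open>y\<close> its value is exactly \<open>y\<close>, so this point
  lies outside \<open>E\<close>; the positive derivative there pushes \<open>f\<close> above
  \<open>y\<close> once more, a contradiction.\<close>

lemma pos_derivative_off_countable_imp_le:
  fixes f :: "real \<Rightarrow> real"
  assumes cont: "continuous_on UNIV f" and "countable E" and "a \<le> b"
    and deriv: "\<And>x. a < x \<Longrightarrow> x < b \<Longrightarrow> x \<notin> E \<Longrightarrow> \<exists>D>0. (f has_real_derivative D) (at x)"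
  shows "f a \<le> f b"
proof (rule ccontr)
  assume "\<not> f a \<le> f b"
  then have less: "f b < f a" by simp
  have "uncountable {f b<..<f a}"
    using less by (simp add: uncountable_open_interval)
  then have "\<not> {f b<..<f a} \<subseteq> f ` E"
    using countable_subset[OF _ countable_image[OF \<open>countable E\<close>]] by metis
  then obtain y where "y \<in> {f b<..<f a}" "y \<notin> f ` E" by blast
  then have y: "f b < y" "y < f a" "y \<notin> f ` E" by auto
  define S where "S = {a..b} \<inter> f -` {y..}"
  have "compact S"
    unfolding S_def using continuous_closed_vimage[OF closed_atLeast, of f y] cont
    by (intro compact_Int_closed) (auto simp: continuous_on_eq_continuous_at)
  moreover have "a \<in> S"
    using y \<open>a \<le> b\<close> by (auto simp: S_def)
  ultimately obtain s where s: "s \<in> S" "\<And>t. t \<in> S \<Longrightarrow> t \<le> s"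
    using compact_attains_sup[of S] by auto
  have "s \<noteq> b" "s \<le> b" "a \<le> s" "y \<le> f s"
    using s(1) y by (auto simp: S_def)
  then have "s < b" by simp
  have after: "f t < y" if "s < t" "t \<le> b" for t
    using s(2)[of t] that \<open>a \<le> s\<close> by (force simp: S_def)
  have "f s \<le> y"
  proof (rule tendsto_upperbound)
    show "(f \<longlongrightarrow> f s) (at_right s)"
      using cont by (simp add: continuous_on_eq_continuous_at isCont_def filterlim_at_split)
    show "\<forall>\<^sub>F t in at_right s. f t \<le> y"
      using eventually_at_right_real[OF \<open>s < b\<close>]
      by eventually_elim (use after in \<open>auto intro: less_imp_le\<close>)
  qed simp
  then have "f s = y" using \<open>y \<le> f s\<close> by simp
  then have "s \<notin> E" "a < s"
    using y \<open>a \<le> s\<close> by (auto simp: less_le)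
  then obtain D where "D > 0" "(f has_real_derivative D) (at s)"
    using deriv \<open>s < b\<close> by blast
  then obtain d where d: "d > 0" "\<And>h. 0 < h \<Longrightarrow> h < d \<Longrightarrow> f s < f (s + h)"
    using DERIV_pos_inc_right by blast
  define h where "h = min (d / 2) (b - s)"
  have "0 < h" "h < d" "s + h \<le> b"
    using d(1) \<open>s < b\<close> by (auto simp: h_def)
  then show False
    using d(2)[of h] after[of "s + h"] \<open>f s = y\<close> by simp
qed

text \<open>Subtracting the line of slope \<open>c - e\<close> makes the derivative strictly
  positive, so the previous lemma applies; then \<open>e\<close> tends to 0.\<close>

lemma nonneg_derivative_off_countable_imp_le:
  fixes f f' :: "real \<Rightarrow> real"
  assumes "continuous_on UNIV f" "countable E" "a \<le> b"
    and "\<And>x. a < x \<Longrightarrow> x < b \<Longrightarrow> x \<notin> E \<Longrightarrow> (f has_real_derivative f' x) (at x) \<and> f' x \<ge> c"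
  shows "c * (b - a) \<le> f b - f a"
proof (cases "a = b")
  case False
  then have "a < b" using \<open>a \<le> b\<close> by simp
  have "c \<le> (f b - f a) / (b - a)"
  proof (rule field_le_epsilon)
    fix e :: real assume "e > 0"
    have "f a - (c - e) * a \<le> f b - (c - e) * b"
    proof (rule pos_derivative_off_countable_imp_le[OF _ \<open>countable E\<close> \<open>a \<le> b\<close>])
      show "continuous_on UNIV (\<lambda>x. f x - (c - e) * x)"
        using assms(1) by (intro continuous_intros)
      fix x assume "a < x" "x < b" "x \<notin> E"
      then have "(f has_real_derivative f' x) (at x)" "f' x \<ge> c" using assms(4) by auto
      then show "\<exists>D>0. ((\<lambda>x. f x - (c - e) * x) has_real_derivative D) (at x)"
        using \<open>e > 0\<close> by (intro exI[of _ "f' x - (c - e)"]) (auto intro!: derivative_eq_intros)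
    qed
    then have "(c - e) * (b - a) \<le> f b - f a" by (simp add: algebra_simps)
    then show "c \<le> (f b - f a) / (b - a) + e"
      using \<open>a < b\<close> by (simp add: field_simps)
  qed
  then show ?thesis using \<open>a < b\<close> by (simp add: field_simps)
qed simp

text \<open>A monotone \<open>\<psi>\<close> has countably many discontinuities, and between
  \<open>x\<close> and \<open>y\<close> its values stay on one side of \<open>\<psi> x\<close>, so
  the slope bound off a countable set applies.\<close>

lemma monotone_derivative_subgradient:
  assumes "monotone_derivative \<Psi> \<psi>"
  shows "\<Psi> x + \<psi> x * (y - x) \<le> \<Psi> y"
proof -
  have mono: "mono \<psi>" and cont: "continuous_on UNIV \<Psi>"
    and deriv: "isCont \<psi> z \<Longrightarrow> (\<Psi> has_real_derivative \<psi> z) (at z)" for z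
    using assms by (auto simp: monotone_derivative_def)
  note ctble = mono_ctble_discont[OF mono]
  show ?thesis
  proof (cases "x \<le> y")
    case True
    have "\<psi> x * (y - x) \<le> \<Psi> y - \<Psi> x"
      using deriv monoD[OF mono]
      by (intro nonneg_derivative_off_countable_imp_le[OF cont ctble True, where f' = \<psi>]) auto
    then show ?thesis by simp
  next
    case False
    \<comment> \<open>To the left of \<open>x\<close> the score is at most \<open>\<psi> x\<close>;
      negation turns this into a lower bound on a slope.\<close>
    then have "- \<psi> x * (x - y) \<le> (- \<Psi> x) - (- \<Psi> y)"
      using deriv monoD[OF mono]
      by (intro nonneg_derivative_off_countable_imp_le[OF continuous_on_minus[OF cont] ctble,
            where f' = "\<lambda>z. - \<psi> z"]) (auto intro: DERIV_minus)
    then show ?thesis by (simp add: algebra_simps)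
  qed
qed

section \<open>Cost and score of a sample; minimizers located by the sign of the score\<close>

text \<open>With \<open>f = \<Psi>\<close> this is the negative log-likelihood at location
  \<open>m\<close>, with \<open>f = \<psi>\<close> the score.\<close>

definition shift_sum :: "(real \<Rightarrow> real) \<Rightarrow> nat \<Rightarrow> (nat \<Rightarrow> real) \<Rightarrow> real \<Rightarrow> real" where
  "shift_sum f N x m = (\<Sum>n\<in>{1..N}. f (x n - m))"

definition minimizes_cost :: "(real \<Rightarrow> real) \<Rightarrow> nat \<Rightarrow> (nat \<Rightarrow> real) \<Rightarrow> real \<Rightarrow> bool" where
  "minimizes_cost \<Psi> N x m \<longleftrightarrow> (\<forall>m'. shift_sum \<Psi> N x m \<le> shift_sum \<Psi> N x m')"

lemma shift_sum_reflect:
  "shift_sum (\<lambda>z. f (- z)) N x m = shift_sum f N (\<lambda>n. - x n) (- m)"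
  by (simp add: shift_sum_def)

lemma minimizes_cost_reflect:
  "minimizes_cost (\<lambda>z. \<Psi> (- z)) N x m \<longleftrightarrow> minimizes_cost \<Psi> N (\<lambda>n. - x n) (- m)"
proof -
  have "(\<forall>m'. P (- m')) \<longleftrightarrow> (\<forall>m'. P m')" for P :: "real \<Rightarrow> bool"
    by (metis minus_minus)
  then show ?thesis by (simp add: minimizes_cost_def shift_sum_reflect)
qed

text \<open>The link between \<open>\<Psi>\<close> and \<open>\<psi>\<close> is kept as a
  subgradient inequality, which makes sense at jumps of \<open>\<psi>\<close> too. One point of each
  sign stands for the sign conditions at infinity, since monotonicity carries the signs into the
  tails.\<close>

locale score_loss =
  fixes \<Psi> \<psi> :: "real \<Rightarrow> real"
  assumes mono_score: "mono \<psi>"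
    and cont_cost: "continuous_on UNIV \<Psi>"
    and subgradient: "\<Psi> x + \<psi> x * (y - x) \<le> \<Psi> y"
    and score_neg: "\<exists>a. \<psi> a < 0"
    and score_pos: "\<exists>b. \<psi> b > 0"
begin

text \<open>Reflection exchanges the two tails, so one-sided arguments are given once and
  transferred by interpreting the locale at the reflected pair.\<close>

lemma score_loss_reflect: "score_loss (\<lambda>z. \<Psi> (- z)) (\<lambda>z. - \<psi> (- z))"
proof
  show "mono (\<lambda>z. - \<psi> (- z))"
    using mono_score by (auto simp: mono_def)
  show "continuous_on UNIV (\<lambda>z. \<Psi> (- z))"
    by (intro continuous_on_compose2[OF cont_cost] continuous_intros) auto
  show "\<Psi> (- x) + - \<psi> (- x) * (y - x) \<le> \<Psi> (- y)" for x y
    using subgradient[of "- x" "- y"] by (simp add: algebra_simps)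
  show "\<exists>a. - \<psi> (- a) < 0" "\<exists>b. - \<psi> (- b) > 0"
    using score_pos score_neg by (metis minus_minus neg_less_0_iff_less neg_0_less_iff_less)+
qed

lemma cont_shift_sum: "continuous_on S (shift_sum \<Psi> N x)"
  unfolding shift_sum_def
  by (intro continuous_intros continuous_on_compose2[OF cont_cost]) auto

lemma score_antimono: "s \<le> t \<Longrightarrow> shift_sum \<psi> N x t \<le> shift_sum \<psi> N x s"
  unfolding shift_sum_def by (intro sum_mono monoD[OF mono_score]) auto

text \<open>The location enters each term with a minus sign, so it is minus the score that is a
  subgradient of the cost at \<open>t\<close>.\<close>

lemma shift_sum_subgradient:
  "shift_sum \<Psi> N x t - shift_sum \<psi> N x t * (m - t) \<le> shift_sum \<Psi> N x m"
proof -
  have "shift_sum \<Psi> N x t - shift_sum \<psi> N x t * (m - t)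
      = (\<Sum>n\<in>{1..N}. \<Psi> (x n - t) + \<psi> (x n - t) * (t - m))"
    by (simp add: shift_sum_def sum.distrib sum_distrib_left sum_distrib_right sum_subtractf algebra_simps)
  also have "\<dots> \<le> shift_sum \<Psi> N x m"
    unfolding shift_sum_def
  proof (rule sum_mono)
    fix n
    show "\<Psi> (x n - t) + \<psi> (x n - t) * (t - m) \<le> \<Psi> (x n - m)"
      using subgradient[of "x n - t" "x n - m"] by simp
  qed
  finally show ?thesis .
qed

text \<open>A negative score at \<open>t\<close> is a positive slope of the convex cost, so every
  point to the right of \<open>t\<close> costs strictly more than \<open>t\<close>.\<close>

lemma minimizer_le:
  assumes "minimizes_cost \<Psi> N x m" "shift_sum \<psi> N x t < 0"
  shows "m \<le> t"
proof (rule ccontr)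
  assume "\<not> m \<le> t"
  then have "shift_sum \<psi> N x t * (m - t) < 0"
    using assms(2) by (simp add: mult_neg_pos)
  moreover have "shift_sum \<Psi> N x m \<le> shift_sum \<Psi> N x t"
    using assms(1) by (simp add: minimizes_cost_def)
  ultimately show False using shift_sum_subgradient[of N x t m] by linarith
qed

lemma minimizer_ge:
  assumes "minimizes_cost \<Psi> N x m" "shift_sum \<psi> N x t > 0"
  shows "t \<le> m"
proof (rule ccontr)
  assume "\<not> t \<le> m"
  then have "shift_sum \<psi> N x t * (m - t) < 0"
    using assms(2) by (simp add: mult_pos_neg)
  moreover have "shift_sum \<Psi> N x m \<le> shift_sum \<Psi> N x t"
    using assms(1) by (simp add: minimizes_cost_def)
  ultimately show False using shift_sum_subgradient[of N x t m] by linarith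
qed

text \<open>At a jump the score at \<open>m\<close> itself may have either sign, hence the
  restriction to \<open>t\<close> different from \<open>m\<close>. For the converse, the subgradient
  at a point \<open>t\<close> between \<open>m\<close> and \<open>m'\<close> shows that
  \<open>t\<close> costs no more than \<open>m'\<close>; continuity of the cost then lets
  \<open>t\<close> tend to \<open>m\<close>.\<close>

lemma minimizes_cost_iff_score_sign:
  "minimizes_cost \<Psi> N x m \<longleftrightarrow>
     (\<forall>t>m. shift_sum \<psi> N x t \<le> 0) \<and> (\<forall>t<m. 0 \<le> shift_sum \<psi> N x t)"
proof
  assume "minimizes_cost \<Psi> N x m"
  then show "(\<forall>t>m. shift_sum \<psi> N x t \<le> 0) \<and> (\<forall>t<m. 0 \<le> shift_sum \<psi> N x t)"
    using minimizer_le minimizer_ge by (meson leD linorder_not_le)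
next
  assume sign: "(\<forall>t>m. shift_sum \<psi> N x t \<le> 0) \<and> (\<forall>t<m. 0 \<le> shift_sum \<psi> N x t)"
  have lim: "(shift_sum \<Psi> N x \<longlongrightarrow> shift_sum \<Psi> N x m) (at m)"
    using cont_shift_sum[of UNIV N x] by (simp add: continuous_on_eq_continuous_at isCont_def)
  show "minimizes_cost \<Psi> N x m"
    unfolding minimizes_cost_def
  proof
    fix m'
    consider "m' = m" | "m < m'" | "m' < m" by linarith
    then show "shift_sum \<Psi> N x m \<le> shift_sum \<Psi> N x m'"
    proof cases
      case 2
      show ?thesis
      proof (rule tendsto_upperbound)
        show "(shift_sum \<Psi> N x \<longlongrightarrow> shift_sum \<Psi> N x m) (at_right m)"
          using lim by (simp add: filterlim_at_split)
        show "\<forall>\<^sub>F t in at_right m. shift_sum \<Psi> N x t \<le> shift_sum \<Psi> N x m'"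
          using eventually_at_right_real[OF 2]
        proof eventually_elim
          case (elim t)
          then have "shift_sum \<psi> N x t * (m' - t) \<le> 0"
            using sign by (simp add: mult_nonpos_nonneg)
          then show ?case using shift_sum_subgradient[of N x t m'] by linarith
        qed
      qed simp
    next
      case 3
      show ?thesis
      proof (rule tendsto_upperbound)
        show "(shift_sum \<Psi> N x \<longlongrightarrow> shift_sum \<Psi> N x m) (at_left m)"
          using lim by (simp add: filterlim_at_split)
        show "\<forall>\<^sub>F t in at_left m. shift_sum \<Psi> N x t \<le> shift_sum \<Psi> N x m'"
          using eventually_at_left_real[OF 3]
        proof eventually_elim
          case (elim t)
          then have "shift_sum \<psi> N x t * (m' - t) \<le> 0"
            using sign by (simp add: mult_nonneg_nonpos)
          then show ?case using shift_sum_subgradient[of N x t m'] by linarith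
        qed
      qed simp
    qed simp
  qed
qed

text \<open>A zero of the antitone score at \<open>t\<close> would give \<open>t\<close> the sign
  pattern of a second minimizer.\<close>

lemma unique_minimizer_score:
  assumes min: "minimizes_cost \<Psi> N x m" and unique: "\<And>m'. minimizes_cost \<Psi> N x m' \<Longrightarrow> m' = m"
  shows "t > m \<Longrightarrow> shift_sum \<psi> N x t < 0" and "t < m \<Longrightarrow> 0 < shift_sum \<psi> N x t"
proof -
  have sign: "(\<forall>t>m. shift_sum \<psi> N x t \<le> 0) \<and> (\<forall>t<m. 0 \<le> shift_sum \<psi> N x t)"
    using min by (simp add: minimizes_cost_iff_score_sign)
  show "shift_sum \<psi> N x t < 0" if "t > m"
  proof (rule ccontr)
    assume "\<not> shift_sum \<psi> N x t < 0"
    then have "minimizes_cost \<Psi> N x t"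
      unfolding minimizes_cost_iff_score_sign using sign that
      by (smt (verit) score_antimono)
    then show False using unique that by blast
  qed
  show "0 < shift_sum \<psi> N x t" if "t < m"
  proof (rule ccontr)
    assume "\<not> 0 < shift_sum \<psi> N x t"
    then have "minimizes_cost \<Psi> N x t"
      unfolding minimizes_cost_iff_score_sign using sign that
      by (smt (verit) score_antimono)
    then show False using unique that by blast
  qed
qed

text \<open>The score is antitone in the location, so its one-sided limits at \<open>m\<close>
  exist: the left one is the infimum \<open>a\<close> over the left side, the right one the supremum
  \<open>b\<close> over the right side. Minimality thus says \<open>b \<le> 0\<close> and
  \<open>0 \<le> a\<close>.\<close>

lemma minimizes_cost_iff_solves_score_equation:
  "minimizes_cost \<Psi> N x m \<longleftrightarrow> solves_score_equation \<psi> N x m"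
proof -
  let ?g = "shift_sum \<psi> N x"
  define a where "a = Inf (?g ` {..<m})"
  define b where "b = Sup (?g ` {m<..})"
  have bdd: "bdd_below (?g ` {..<m})" "bdd_above (?g ` {m<..})"
    by (auto intro!: bdd_belowI[of _ "?g m"] bdd_aboveI[of _ "?g m"] score_antimono)
  \<comment> \<open>Negation makes the score nondecreasing, as \<open>Lim_left_bound\<close>
    requires.\<close>
  have "((\<lambda>t. - ?g t) \<longlongrightarrow> Sup ((\<lambda>t. - ?g t) ` ({..<m} \<inter> UNIV))) (at m within ({..<m} \<inter> UNIV))"
    by (rule Lim_left_bound[where K = "- ?g m"]) (auto intro: score_antimono)
  from tendsto_minus[OF this] have left: "(?g \<longlongrightarrow> a) (at_left m)"
    by (simp add: a_def Inf_real_def image_image)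
  have "((\<lambda>t. - ?g t) \<longlongrightarrow> Inf ((\<lambda>t. - ?g t) ` ({m<..} \<inter> UNIV))) (at m within ({m<..} \<inter> UNIV))"
    by (rule Lim_right_bound[where K = "- ?g m"]) (auto intro: score_antimono)
  from tendsto_minus[OF this] have right: "(?g \<longlongrightarrow> b) (at_right m)"
    by (simp add: b_def Inf_real_def image_image)
  have between: "b \<le> ?g m" "?g m \<le> a"
    unfolding a_def b_def by (auto intro!: cSup_least cInf_greatest score_antimono)
  have "minimizes_cost \<Psi> N x m \<longleftrightarrow> b \<le> 0 \<and> 0 \<le> a"
    unfolding minimizes_cost_iff_score_sign a_def b_def
    using cSup_le_iff[of "?g ` {m<..}" 0] le_cInf_iff[of "?g ` {..<m}" 0] bdd by auto
  \<comment> \<open>If \<open>b \<le> 0 \<le> a\<close> and the signs agree, both limits vanish and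
    so does \<open>?g m\<close> between them. Conversely, distinct signs together with
    \<open>b \<le> a\<close> leave 0 between the limits.\<close>
  also have "\<dots> \<longleftrightarrow> ?g m = 0 \<or> sgn a \<noteq> sgn b"
    using between by (auto simp: sgn_if split: if_splits)
  also have "\<dots> \<longleftrightarrow> ?g m = 0 \<or>
      (\<exists>a b. (?g \<longlongrightarrow> a) (at_left m) \<and> (?g \<longlongrightarrow> b) (at_right m) \<and> sgn a \<noteq> sgn b)"
    using left right tendsto_unique[OF trivial_limit_at_left_real]
      tendsto_unique[OF trivial_limit_at_right_real] by metis
  finally show ?thesis by (simp add: solves_score_equation_def shift_sum_def[abs_def])
qed

section \<open>Existence of minimizers\<close>

lemma score_eventually_neg:
  assumes "N \<ge> 1" obtains t where "shift_sum \<psi> N x t < 0"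
proof -
  obtain a where a: "\<psi> a < 0" using score_neg by blast
  \<comment> \<open>At this location every residual is at most \<open>a\<close>, so every summand of
    the score is negative.\<close>
  define t where "t = Max (x ` {1..N}) - a"
  have "\<psi> (x n - t) < 0" if "n \<in> {1..N}" for n
  proof -
    have "x n \<le> Max (x ` {1..N})" using that by simp
    then have "\<psi> (x n - t) \<le> \<psi> a" by (intro monoD[OF mono_score]) (simp add: t_def)
    then show ?thesis using a by simp
  qed
  then have "shift_sum \<psi> N x t < (\<Sum>n\<in>{1..N}. 0)"
    unfolding shift_sum_def using assms by (intro sum_strict_mono) auto
  then show thesis using that by simp
qed

lemma score_eventually_pos:
  assumes "N \<ge> 1" obtains t where "0 < shift_sum \<psi> N x t"
proof -
  interpret refl: score_loss "\<lambda>z. \<Psi> (- z)" "\<lambda>z. - \<psi> (- z)" by (rule score_loss_reflect)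
  obtain t where "shift_sum (\<lambda>z. - \<psi> (- z)) N (\<lambda>n. - x n) t < 0"
    using refl.score_eventually_neg[OF assms] .
  then show thesis
    by (intro that[of "- t"]) (simp add: shift_sum_def sum_negf add.commute)
qed

text \<open>Locations with positive and negative score bracket a compact interval on which the
  continuous cost attains its minimum; beyond an end of it the subgradient there keeps the cost at
  least as large as at that end.\<close>

lemma minimizer_exists:
  assumes "N \<ge> 1" obtains m where "minimizes_cost \<Psi> N x m"
proof -
  obtain t1 where t1: "shift_sum \<psi> N x t1 < 0" using score_eventually_neg[OF assms] .
  obtain t0 where t0: "0 < shift_sum \<psi> N x t0" using score_eventually_pos[OF assms] .
  have "t0 \<le> t1" using score_antimono[of t1 t0] t0 t1 by (smt (verit))
  then obtain m where m: "m \<in> {t0..t1}" "\<And>t. t \<in> {t0..t1} \<Longrightarrow> shift_sum \<Psi> N x m \<le> shift_sum \<Psi> N x t"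
    using continuous_attains_inf[OF compact_Icc _ cont_shift_sum, of t0 t1 N x] by auto
  have "shift_sum \<Psi> N x m \<le> shift_sum \<Psi> N x t" for t
  proof -
    have "shift_sum \<psi> N x t1 * (t - t1) \<le> 0" if "t \<ge> t1"
      using t1 that by (simp add: mult_nonpos_nonneg)
    moreover have "shift_sum \<psi> N x t0 * (t - t0) \<le> 0" if "t \<le> t0"
      using t0 that by (simp add: mult_nonneg_nonpos)
    ultimately show ?thesis
      using m(2)[of t] m(2)[of t0] m(2)[of t1] \<open>t0 \<le> t1\<close>
        shift_sum_subgradient[of N x t1 t] shift_sum_subgradient[of N x t0 t]
      by (cases "t \<le> t0"; cases "t \<ge> t1") auto
  qed
  then show thesis using that by (auto simp: minimizes_cost_def)
qed

section \<open>Replaced observations and breakdown\<close>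

lemma score_update:
  assumes "i \<in> {1..N}"
  shows "shift_sum f N (x(i := y)) t = f (y - t) + (\<Sum>n\<in>{1..N} - {i}. f (x n - t))"
proof -
  have "shift_sum f N (x(i := y)) t
      = f (y - t) + (\<Sum>n\<in>{1..N} - {i}. f ((x(i := y)) n - t))"
    unfolding shift_sum_def using sum.remove[OF _ assms, of "\<lambda>n. f ((x(i := y)) n - t)"]
    by (simp del: fun_upd_apply add: fun_upd_same)
  also have "(\<Sum>n\<in>{1..N} - {i}. f ((x(i := y)) n - t)) = (\<Sum>n\<in>{1..N} - {i}. f (x n - t))"
    by (intro sum.cong) auto
  finally show ?thesis .
qed

text \<open>At location \<open>B\<close> the other observations contribute a fixed amount, which a
  single observation with large enough score outweighs. The new observation is \<open>z + B\<close>
  because its residual at \<open>B\<close> is then \<open>z\<close>.\<close>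

lemma unbounded_above_imp_large_minimizer:
  assumes unbdd: "\<not> bdd_above (range \<psi>)" and i: "i \<in> {1..N}"
  obtains y m where "minimizes_cost \<Psi> N (x(i := y)) m" "B \<le> m"
proof -
  obtain z where z: "\<psi> z > - (\<Sum>n\<in>{1..N} - {i}. \<psi> (x n - B))"
    using unbdd by (auto simp: bdd_above_def not_le)
  obtain m where m: "minimizes_cost \<Psi> N (x(i := z + B)) m"
    using minimizer_exists[of N] i by auto
  have "shift_sum \<psi> N (x(i := z + B)) B > 0"
    using z by (simp add: score_update[OF i])
  then show thesis using minimizer_ge[OF m] that[OF m] by blast
qed

lemma unbounded_reflect:
  assumes unbdd: "\<not> bounded (range \<psi>)" and bdd: "bdd_above (range \<psi>)"
  shows "\<not> bdd_above (range (\<lambda>z. - \<psi> (- z)))"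
proof
  assume "bdd_above (range (\<lambda>z. - \<psi> (- z)))"
  then obtain c where "- \<psi> (- z) \<le> c" for z by (auto simp: bdd_above_def)
  from this[of "- z" for z] have "- c \<le> \<psi> z" for z by (simp add: minus_le_iff)
  moreover obtain d where "\<And>z. \<psi> z \<le> d" using bdd by (auto simp: bdd_above_def)
  ultimately have "range \<psi> \<subseteq> {- c..d}" by auto
  then show False using unbdd bounded_subset bounded_closed_interval by blast
qed

lemma unbounded_imp_large_minimizer:
  assumes unbdd: "\<not> bounded (range \<psi>)" and i: "i \<in> {1..N}"
  obtains y m where "minimizes_cost \<Psi> N (x(i := y)) m" "B \<le> \<bar>m\<bar>"
proof (cases "bdd_above (range \<psi>)")
  case False
  then show thesis
    using unbounded_above_imp_large_minimizer[OF _ i, of x B] that by (metis abs_ge_self order_trans)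
next
  case True
  \<comment> \<open>Here \<open>\<psi>\<close> is unbounded below, and reflection moves the
    unbounded tail to the right.\<close>
  interpret refl: score_loss "\<lambda>z. \<Psi> (- z)" "\<lambda>z. - \<psi> (- z)" by (rule score_loss_reflect)
  obtain y m where ym: "minimizes_cost (\<lambda>z. \<Psi> (- z)) N ((\<lambda>n. - x n)(i := y)) m" "B \<le> m"
    using refl.unbounded_above_imp_large_minimizer[OF unbounded_reflect[OF unbdd True] i] .
  moreover have "(\<lambda>n. - ((\<lambda>n. - x n)(i := y)) n) = x(i := - y)" by auto
  ultimately show thesis
    using that[of "- y" "- m"] by (simp add: minimizes_cost_reflect)
qed

text \<open>Far to the right each kept observation contributes at most \<open>\<psi> a < 0\<close>
  to the score and each replaced one at most \<open>C\<close>, so a small share of replacements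
  cannot make the score nonnegative.\<close>

lemma bdd_above_imp_breakdown_above:
  assumes "bdd_above (range \<psi>)"
  obtains \<delta> where "\<delta> > 0"
    and "\<And>N x M. M \<subseteq> {1..N} \<Longrightarrow> real (card M) < \<delta> * real N \<Longrightarrow>
      \<exists>B. \<forall>y m. minimizes_cost \<Psi> N (\<lambda>n. if n \<in> M then y n else x n) m \<longrightarrow> m \<le> B"
proof -
  obtain a where a: "\<psi> a < 0" using score_neg by blast
  obtain C where C: "\<psi> z \<le> C" for z using assms by (auto simp: bdd_above_def)
  obtain b where "\<psi> b > 0" using score_pos by blast
  with C[of b] have "C > 0" by simp
  \<comment> \<open>This is the fraction at which
    \<open>card M * C + (N - card M) * \<psi> a\<close> reaches 0.\<close>
  define \<delta> where "\<delta> = - \<psi> a / (C - \<psi> a)"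
  show thesis
  proof (rule that)
    show "\<delta> > 0" using a \<open>C > 0\<close> by (simp add: \<delta>_def divide_neg_pos)
    fix N x and M :: "nat set"
    assume M: "M \<subseteq> {1..N}" and card: "real (card M) < \<delta> * real N"
    have "finite M" using M finite_subset by blast
    have "card M \<le> N" using card_mono[OF _ M] by simp
    \<comment> \<open>The location depends on \<open>x\<close> but not on the replacements
      \<open>y\<close>, which makes the bound uniform in \<open>y\<close>.\<close>
    define t where "t = Max (x ` {1..N}) - a"
    have "shift_sum \<psi> N (\<lambda>n. if n \<in> M then y n else x n) t < 0" for y
    proof -
      have "shift_sum \<psi> N (\<lambda>n. if n \<in> M then y n else x n) t
          \<le> (\<Sum>n\<in>{1..N}. if n \<in> M then C else \<psi> a)"
        unfolding shift_sum_def
      proof (rule sum_mono)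
        fix n assume "n \<in> {1..N}"
        then have "x n \<le> Max (x ` {1..N})" by simp
        then have "x n - t \<le> a" by (simp add: t_def)
        then show "\<psi> ((if n \<in> M then y n else x n) - t) \<le> (if n \<in> M then C else \<psi> a)"
          using C monoD[OF mono_score] by auto
      qed
      also have "\<dots> = real (card M) * C + real (N - card M) * \<psi> a"
        using M \<open>finite M\<close> by (simp add: sum.If_cases Int_absorb1 card_Diff_subset flip: Diff_eq)
      also have "\<dots> = real (card M) * (C - \<psi> a) + real N * \<psi> a"
        using \<open>card M \<le> N\<close> by (simp add: of_nat_diff algebra_simps)
      also have "\<dots> < 0"
        using card a \<open>C > 0\<close> by (simp add: \<delta>_def field_simps)
      finally show ?thesis .
    qed
    then show "\<exists>B. \<forall>y m. minimizes_cost \<Psi> N (\<lambda>n. if n \<in> M then y n else x n) m \<longrightarrow> m \<le> B"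
      using minimizer_le by blast
  qed
qed

lemma bounded_imp_breakdown:
  assumes "bounded (range \<psi>)"
  obtains \<delta> where "\<delta> > 0"
    and "\<And>N x M. M \<subseteq> {1..N} \<Longrightarrow> real (card M) < \<delta> * real N \<Longrightarrow>
      \<exists>B. \<forall>y m. minimizes_cost \<Psi> N (\<lambda>n. if n \<in> M then y n else x n) m \<longrightarrow> \<bar>m\<bar> \<le> B"
proof -
  interpret refl: score_loss "\<lambda>z. \<Psi> (- z)" "\<lambda>z. - \<psi> (- z)" by (rule score_loss_reflect)
  obtain C where C: "\<bar>\<psi> z\<bar> \<le> C" for z using assms by (auto simp: bounded_iff)
  have bdd: "bdd_above (range \<psi>)" "bdd_above (range (\<lambda>z. - \<psi> (- z)))"
    using C by (auto intro!: bdd_aboveI[of _ C] simp: abs_le_iff)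
  obtain \<delta>\<^sub>1 where "\<delta>\<^sub>1 > 0"
    and above: "\<And>N x M. M \<subseteq> {1..N} \<Longrightarrow> real (card M) < \<delta>\<^sub>1 * real N \<Longrightarrow>
      \<exists>B. \<forall>y m. minimizes_cost \<Psi> N (\<lambda>n. if n \<in> M then y n else x n) m \<longrightarrow> m \<le> B"
    using bdd_above_imp_breakdown_above[OF bdd(1)] by blast
  obtain \<delta>\<^sub>2 where "\<delta>\<^sub>2 > 0"
    and below: "\<And>N x M. M \<subseteq> {1..N} \<Longrightarrow> real (card M) < \<delta>\<^sub>2 * real N \<Longrightarrow>
      \<exists>B. \<forall>y m. minimizes_cost (\<lambda>z. \<Psi> (- z)) N (\<lambda>n. if n \<in> M then y n else x n) m \<longrightarrow> m \<le> B"
    using refl.bdd_above_imp_breakdown_above[OF bdd(2)] by blast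
  show thesis
  proof (rule that)
    show "min \<delta>\<^sub>1 \<delta>\<^sub>2 > 0" using \<open>\<delta>\<^sub>1 > 0\<close> \<open>\<delta>\<^sub>2 > 0\<close> by simp
    fix N x and M :: "nat set"
    assume M: "M \<subseteq> {1..N}" and card: "real (card M) < min \<delta>\<^sub>1 \<delta>\<^sub>2 * real N"
    have "min \<delta>\<^sub>1 \<delta>\<^sub>2 * real N \<le> \<delta>\<^sub>1 * real N" "min \<delta>\<^sub>1 \<delta>\<^sub>2 * real N \<le> \<delta>\<^sub>2 * real N"
      by (auto intro: mult_right_mono)
    then have card': "real (card M) < \<delta>\<^sub>1 * real N" "real (card M) < \<delta>\<^sub>2 * real N"
      using card by linarith+
    obtain B\<^sub>1 where B1: "\<And>y m. minimizes_cost \<Psi> N (\<lambda>n. if n \<in> M then y n else x n) m \<Longrightarrow> m \<le> B\<^sub>1"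
      using above[OF M card'(1)] by blast
    obtain B\<^sub>2 where B2: "\<And>y m. minimizes_cost (\<lambda>z. \<Psi> (- z)) N (\<lambda>n. if n \<in> M then y n else - x n) m \<Longrightarrow> m \<le> B\<^sub>2"
      using below[OF M card'(2), of "\<lambda>n. - x n"] by blast
    have "\<bar>m\<bar> \<le> max B\<^sub>1 B\<^sub>2" if "minimizes_cost \<Psi> N (\<lambda>n. if n \<in> M then y n else x n) m" for y m
    proof -
      have "(\<lambda>n. - (if n \<in> M then - y n else - x n)) = (\<lambda>n. if n \<in> M then y n else x n)" by auto
      then have "- m \<le> B\<^sub>2"
        using that by (intro B2[of "\<lambda>n. - y n"]) (simp add: minimizes_cost_reflect)
      then show ?thesis using B1[OF that] by auto
    qed
    then show "\<exists>B. \<forall>y m. minimizes_cost \<Psi> N (\<lambda>n. if n \<in> M then y n else x n) m \<longrightarrow> \<bar>m\<bar> \<le> B"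
      by blast
  qed
qed

section \<open>Growth of the cost compared with linear functions\<close>

text \<open>For \<open>m \<ge> 0\<close> the linear term is nonpositive and \<open>\<Psi>\<close> is
  bounded below. For \<open>m < 0\<close> a supporting line of \<open>\<Psi>\<close> with slope
  above \<open>- \<beta>\<close> dominates the linear term.\<close>

lemma unbounded_above_imp_linear_minus_cost_bdd:
  assumes unbdd: "\<not> bdd_above (range \<psi>)" and "\<beta> \<le> 0"
  shows "\<exists>K. \<forall>m. \<beta> * m - \<Psi> (- m) \<le> K"
proof -
  \<comment> \<open>A one-point sample at 0 yields the global minimum of
    \<open>\<Psi>\<close>.\<close>
  obtain m\<^sub>0 where "minimizes_cost \<Psi> 1 (\<lambda>_. 0) m\<^sub>0" using minimizer_exists[of 1] by auto
  then have low: "\<Psi> (- m\<^sub>0) \<le> \<Psi> (- m)" for m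
    by (auto simp: minimizes_cost_def shift_sum_def)
  obtain s where s: "\<psi> s > - \<beta>" using unbdd by (auto simp: bdd_above_def not_le)
  have "\<beta> * m - \<Psi> (- m) \<le> max (- \<Psi> (- m\<^sub>0)) (\<psi> s * s - \<Psi> s)" for m
  proof (cases "m \<ge> 0")
    case True
    then have "\<beta> * m \<le> 0" using \<open>\<beta> \<le> 0\<close> by (simp add: mult_nonpos_nonneg)
    then show ?thesis using low[of m] by linarith
  next
    case False
    then have "(\<beta> + \<psi> s) * m \<le> 0" using s by (intro mult_nonneg_nonpos) auto
    then have "\<beta> * m + \<psi> s * m \<le> 0" by (simp add: distrib_right)
    moreover have "\<Psi> s - \<psi> s * m - \<psi> s * s \<le> \<Psi> (- m)"
      using subgradient[of s "- m"] by (simp add: algebra_simps)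
    ultimately show ?thesis by linarith
  qed
  then show ?thesis by blast
qed

text \<open>The sign of \<open>\<beta>\<close> depends on which tail of \<open>\<psi>\<close> is
  unbounded. One sign suffices to contradict a claim about all \<open>\<beta>\<close> of large
  absolute value.\<close>

lemma unbounded_imp_linear_minus_cost_bdd:
  assumes "\<not> bounded (range \<psi>)"
  obtains \<beta> K where "B \<le> \<bar>\<beta>\<bar>" "\<And>m. \<beta> * m - \<Psi> (- m) \<le> K"
proof (cases "bdd_above (range \<psi>)")
  case False
  then obtain K where "\<forall>m. - \<bar>B\<bar> * m - \<Psi> (- m) \<le> K"
    using unbounded_above_imp_linear_minus_cost_bdd[of "- \<bar>B\<bar>"] by auto
  then show thesis using that[of "- \<bar>B\<bar>" K] by auto
next
  case True
  interpret refl: score_loss "\<lambda>z. \<Psi> (- z)" "\<lambda>z. - \<psi> (- z)" by (rule score_loss_reflect)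
  have "\<not> bdd_above (range (\<lambda>z. - \<psi> (- z)))"
    using True assms unbounded_reflect by blast
  then obtain K where K: "\<forall>m. - \<bar>B\<bar> * m - \<Psi> m \<le> K"
    using refl.unbounded_above_imp_linear_minus_cost_bdd[of "- \<bar>B\<bar>"] by auto
  show thesis using that[of "\<bar>B\<bar>" K] spec[OF K, of "- m" for m] by auto
qed

text \<open>The cost grows at most linearly with slope \<open>N * C\<close>, so in the direction of
  the sign of \<open>\<beta>\<close> the difference grows at rate at least
  \<open>\<bar>\<beta>\<bar> - N * C / k > 0\<close>.\<close>

lemma bounded_imp_linear_minus_cost_unbounded:
  assumes C: "\<And>z. \<bar>\<psi> z\<bar> \<le> C" and "k > 0" and \<beta>: "real N * C / k < \<bar>\<beta>\<bar>"
  shows "\<exists>m. K < \<beta> * m - shift_sum \<Psi> N x m / k"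
proof -
  let ?L = "shift_sum \<Psi> N x"
  have growth: "?L m \<le> ?L 0 + real N * C * \<bar>m\<bar>" for m
  proof -
    have "\<bar>shift_sum \<psi> N x m\<bar> \<le> (\<Sum>n\<in>{1..N}. C)"
      unfolding shift_sum_def by (rule order_trans[OF sum_abs sum_mono]) (rule C)
    then have "\<bar>shift_sum \<psi> N x m * m\<bar> \<le> real N * C * \<bar>m\<bar>"
      by (simp add: abs_mult mult_right_mono)
    moreover have "?L m + shift_sum \<psi> N x m * m \<le> ?L 0"
      using shift_sum_subgradient[of N x m 0] by simp
    ultimately show ?thesis by linarith
  qed
  define c where "c = \<bar>\<beta>\<bar> - real N * C / k"
  have "c > 0" using \<beta> by (simp add: c_def)
  \<comment> \<open>Chosen so that \<open>c * t\<close> exceeds \<open>K + ?L 0 / k\<close>; the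
    summand 1 makes this strict and keeps \<open>t\<close> positive.\<close>
  define t where "t = max 0 ((K + ?L 0 / k) / c) + 1"
  have "t > 0" by (simp add: t_def)
  have "K + ?L 0 / k < c * t"
  proof -
    have "(K + ?L 0 / k) / c < t" by (simp add: t_def)
    then show ?thesis using \<open>c > 0\<close> by (simp add: field_simps)
  qed
  define m where "m = (if \<beta> < 0 then - t else t)"
  have m: "\<beta> * m = \<bar>\<beta>\<bar> * t" "\<bar>m\<bar> = t" using \<open>t > 0\<close> by (auto simp: m_def)
  have "?L m / k \<le> ?L 0 / k + real N * C / k * t"
    using growth[of m] \<open>k > 0\<close> m by (simp add: field_simps)
  with \<open>K + ?L 0 / k < c * t\<close> have "K < \<beta> * m - ?L m / k"
    by (simp add: m c_def left_diff_distrib)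
  then show ?thesis by blast
qed

section \<open>Samples with a unique minimizer and stability of that minimizer\<close>

text \<open>Zeros of \<open>\<psi>\<close> may fill an interval, so a one-point sample can have many
  minimizers. With observations at both ends of that interval, the \<open>q\<close> term is strictly
  negative for \<open>t > 0\<close>, the \<open>p\<close> term strictly positive for
  \<open>t < 0\<close>, and the other term never has the opposite sign.\<close>

lemma two_point_score_sign:
  obtains p q where "\<And>t. t > 0 \<Longrightarrow> \<psi> (p - t) + \<psi> (q - t) < 0"
    and "\<And>t. t < 0 \<Longrightarrow> 0 < \<psi> (p - t) + \<psi> (q - t)"
proof -
  obtain a b where ab: "\<psi> a < 0" "\<psi> b > 0" using score_neg score_pos by blast
  define p where "p = Sup {z. \<psi> z \<le> 0}"
  define q where "q = Inf {z. \<psi> z \<ge> 0}"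
  have less: "z < w" if "\<psi> z < \<psi> w" for z w
    using that monoD[OF mono_score, of w z] by (meson leD linorder_not_le)
  have bdd: "bdd_above {z. \<psi> z \<le> 0}" "bdd_below {z. \<psi> z \<ge> 0}"
    using less[of _ b] less[of a] ab
    by (auto intro!: bdd_aboveI[of _ b] bdd_belowI[of _ a] less_imp_le)
  have p1: "\<psi> z \<le> 0" if z: "z < p" for z
  proof -
    obtain w where "w \<in> {z. \<psi> z \<le> 0}" "z < w"
      using less_cSupD[of "{z. \<psi> z \<le> 0}" z] z ab(1) unfolding p_def by (force intro: less_imp_le)
    then show ?thesis using monoD[OF mono_score, of z w] by auto
  qed
  have p2: "\<psi> z > 0" if "p < z" for z
    using cSup_upper[OF _ bdd(1), of z] that unfolding p_def by force
  have q1: "\<psi> z \<ge> 0" if z: "q < z" for z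
  proof -
    obtain w where "w \<in> {z. \<psi> z \<ge> 0}" "w < z"
      using cInf_lessD[of "{z. \<psi> z \<ge> 0}" z] z ab(2) unfolding q_def by (force intro: less_imp_le)
    then show ?thesis using monoD[OF mono_score, of w z] by auto
  qed
  have q2: "\<psi> z < 0" if "z < q" for z
    using cInf_lower[OF _ bdd(2), of z] that unfolding q_def by force
  show thesis
    using p1 p2 q1 q2 by (intro that[of p q] add_nonpos_neg add_pos_nonneg) auto
qed

text \<open>Uniqueness makes the limiting score strictly signed on either side of
  \<open>m\<^sub>0\<close>. Strict signs of averages persist for large \<open>j\<close> and trap the
  minimizers \<open>m j\<close> near \<open>m\<^sub>0\<close>.\<close>

lemma bounded_imp_minimizer_tendsto:
  assumes bounded: "bounded (range \<psi>)"
    and "N\<^sub>0 \<ge> 1" and min0: "minimizes_cost \<Psi> N\<^sub>0 x\<^sub>0 m\<^sub>0"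
    and unique: "\<And>m'. minimizes_cost \<Psi> N\<^sub>0 x\<^sub>0 m' \<Longrightarrow> m' = m\<^sub>0"
    and N: "\<And>j. N j \<ge> 1" and min: "\<And>j. minimizes_cost \<Psi> (N j) (x j) (m j)"
    and averages: "\<And>f C. continuous_on UNIV f \<Longrightarrow> (\<And>z. \<bar>f z\<bar> \<le> C) \<Longrightarrow>
      (\<lambda>j. (\<Sum>n\<in>{1..N j}. f (x j n)) / real (N j)) \<longlonglongrightarrow> (\<Sum>n\<in>{1..N\<^sub>0}. f (x\<^sub>0 n)) / real N\<^sub>0"
  shows "m \<longlonglongrightarrow> (m\<^sub>0 :: real)"
proof -
  obtain C where C: "\<bar>\<psi> z\<bar> \<le> C" for z using bounded by (auto simp: bounded_iff)
  text \<open>The difference quotients of \<open>\<Psi>\<close> are continuous functions sandwiched between translates of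
    the possibly discontinuous \<open>\<psi>\<close>.\<close>
  define h where "h e z = (\<Psi> (z + e) - \<Psi> z) / e" for e z
  have h: "\<psi> z \<le> h e z" "h e z \<le> \<psi> (z + e)" if "e > 0" for e z
    using subgradient[of z "z + e"] subgradient[of "z + e" z] that
    by (auto simp: h_def field_simps)
  have hC: "\<bar>h e z\<bar> \<le> C" if "e > 0" for e z
    using h[OF that, of z] C[of z] C[of "z + e"] by (simp add: abs_le_iff)
  have cont: "continuous_on UNIV (\<lambda>z. h e (z - t))" if "e > 0" for e t
    unfolding h_def using that
    by (intro continuous_intros continuous_on_compose2[OF cont_cost]) auto
  have lim: "(\<lambda>j. shift_sum (h e) (N j) (x j) t / real (N j))
      \<longlonglongrightarrow> shift_sum (h e) N\<^sub>0 x\<^sub>0 t / real N\<^sub>0" if "e > 0" for e t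
    unfolding shift_sum_def using that by (intro averages[OF cont]) (auto intro: hC)
  have shift: "shift_sum (\<lambda>z. \<psi> (z + e)) M y t = shift_sum \<psi> M y (t - e)" for e M y t
    by (simp add: shift_sum_def algebra_simps)
  have bounds: "shift_sum \<psi> M y t \<le> shift_sum (h e) M y t"
    "shift_sum (h e) M y t \<le> shift_sum \<psi> M y (t - e)" if "e > 0" for e M y t
    unfolding shift[symmetric] unfolding shift_sum_def using h[OF that] by (auto intro: sum_mono)
  note sign = unique_minimizer_score[OF min0 unique]
  have close: "\<forall>\<^sub>F j in sequentially. \<bar>m j - m\<^sub>0\<bar> \<le> e" if "e > 0" for e
  proof -
    \<comment> \<open>The quotient sum here is at most the score at
      \<open>m\<^sub>0 + e / 2\<close>, still to the right of \<open>m\<^sub>0\<close>.\<close>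
    have "shift_sum (h (e / 2)) N\<^sub>0 x\<^sub>0 (m\<^sub>0 + e) < 0"
      using bounds(2)[of "e / 2" N\<^sub>0 x\<^sub>0 "m\<^sub>0 + e"] sign(1)[of "m\<^sub>0 + e - e / 2"] \<open>e > 0\<close> by simp
    then have "shift_sum (h (e / 2)) N\<^sub>0 x\<^sub>0 (m\<^sub>0 + e) / real N\<^sub>0 < 0"
      using \<open>N\<^sub>0 \<ge> 1\<close> by (simp add: divide_neg_pos)
    then have "\<forall>\<^sub>F j in sequentially. shift_sum (h (e / 2)) (N j) (x j) (m\<^sub>0 + e) / real (N j) < 0"
      using order_tendstoD(2)[OF lim] \<open>e > 0\<close> by simp
    moreover
    \<comment> \<open>Evaluation at \<open>m\<^sub>0 - e / 2\<close> makes the upper bound on the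
      quotient sum the score at \<open>m\<^sub>0 - e\<close>.\<close>
    have "0 < shift_sum (h (e / 2)) N\<^sub>0 x\<^sub>0 (m\<^sub>0 - e / 2)"
      using bounds(1)[of "e / 2" N\<^sub>0 x\<^sub>0 "m\<^sub>0 - e / 2"] sign(2)[of "m\<^sub>0 - e / 2"] \<open>e > 0\<close> by simp
    then have "0 < shift_sum (h (e / 2)) N\<^sub>0 x\<^sub>0 (m\<^sub>0 - e / 2) / real N\<^sub>0"
      using \<open>N\<^sub>0 \<ge> 1\<close> by simp
    then have "\<forall>\<^sub>F j in sequentially. 0 < shift_sum (h (e / 2)) (N j) (x j) (m\<^sub>0 - e / 2) / real (N j)"
      using order_tendstoD(1)[OF lim] \<open>e > 0\<close> by simp
    ultimately show ?thesis
    proof eventually_elim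
      case (elim j)
      have "real (N j) > 0" using N[of j] by simp
      then have "shift_sum (h (e / 2)) (N j) (x j) (m\<^sub>0 + e) < 0"
        "0 < shift_sum (h (e / 2)) (N j) (x j) (m\<^sub>0 - e / 2)"
        using elim by (auto simp: divide_less_0_iff zero_less_divide_iff)
      then have "shift_sum \<psi> (N j) (x j) (m\<^sub>0 + e) < 0" "0 < shift_sum \<psi> (N j) (x j) (m\<^sub>0 - e)"
        using bounds(1)[of "e / 2" "N j" "x j" "m\<^sub>0 + e"]
          bounds(2)[of "e / 2" "N j" "x j" "m\<^sub>0 - e / 2"] \<open>e > 0\<close> by auto
      then show ?case using minimizer_le[OF min] minimizer_ge[OF min] by (smt (verit))
    qed
  qed
  show ?thesis
    unfolding tendsto_iff dist_real_def
  proof (intro allI impI)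
    fix e :: real assume "e > 0"
    then have "e / 2 > 0" by simp
    from close[OF this] show "\<forall>\<^sub>F j in sequentially. \<bar>m j - m\<^sub>0\<bar> < e"
      by eventually_elim (use \<open>e > 0\<close> in simp)
  qed
qed

end

section \<open>Empirical cdfs and weak convergence\<close>

text \<open>An empirical cdf is the cdf of the image of the uniform measure on the indices under the
  sample, and integrals against that image are sample averages.\<close>

lemma weak_conv_empirical_cdf_imp_averages_tendsto:
  assumes N: "\<And>j. N j \<ge> 1" and "N\<^sub>0 \<ge> 1"
    and weak: "weak_conv (\<lambda>j. empirical_cdf (N j) (x j)) (empirical_cdf N\<^sub>0 x\<^sub>0)"
    and cont: "continuous_on UNIV f" and bound: "\<And>z. \<bar>f z\<bar> \<le> (C :: real)"
  shows "(\<lambda>j. (\<Sum>n\<in>{1..N j}. f (x j n)) / real (N j)) \<longlonglongrightarrow> (\<Sum>n\<in>{1..N\<^sub>0}. f (x\<^sub>0 n)) / real N\<^sub>0"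
proof -
  define D :: "nat \<Rightarrow> (nat \<Rightarrow> real) \<Rightarrow> real measure"
    where "D M y = distr (uniform_count_measure {1..M}) borel y" for M y
  have meas: "y \<in> borel_measurable (uniform_count_measure {1..M})" for y :: "nat \<Rightarrow> real" and M
    by (simp add: uniform_count_measure_def)
  have dist: "real_distribution (D M y)" if "M \<ge> 1" for M y
    unfolding D_def using that
    by (intro prob_space.real_distribution_distr prob_space_uniform_count_measure meas) auto
  have cdf: "cdf (D M y) = empirical_cdf M y" for M y
  proof
    fix t
    have "cdf (D M y) t = measure (uniform_count_measure {1..M}) {n \<in> {1..M}. y n \<le> t}"
      unfolding cdf_def D_def
      by (subst measure_distr[OF meas]) (auto simp: space_uniform_count_measure intro!: arg_cong[where f = "measure _"])
    then show "cdf (D M y) t = empirical_cdf M y t"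
      by (subst (asm) measure_uniform_count_measure) (auto simp: empirical_cdf_def)
  qed
  have borel: "f \<in> borel_measurable borel"
    using cont by (rule borel_measurable_continuous_onI)
  have avg: "integral\<^sup>L (D M y) f = (\<Sum>n\<in>{1..M}. f (y n)) / real M" for M y
    unfolding D_def by (subst integral_distr[OF meas borel]) (simp add: integral_uniform_count_measure)
  have "(\<lambda>j. integral\<^sup>L (D (N j) (x j)) f) \<longlonglongrightarrow> integral\<^sup>L (D N\<^sub>0 x\<^sub>0) f"
    using weak cont bound N \<open>N\<^sub>0 \<ge> 1\<close>
    by (intro weak_conv_imp_integral_bdd_continuous_conv[where B = C] dist)
      (auto simp: weak_conv_m_def cdf continuous_on_eq_continuous_at)
  then show ?thesis by (simp add: avg)
qed

lemma empirical_cdf_eq_sum: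
  "empirical_cdf N x t = (\<Sum>n\<in>{1..N}. of_bool (x n \<le> t)) / real N"
proof -
  have "(\<Sum>n\<in>{1..N}. of_bool (x n \<le> t)) = real (card {n \<in> {1..N}. x n \<le> t})"
    by (simp add: of_bool_def sum.If_cases Int_def)
  then show ?thesis by (simp add: empirical_cdf_def)
qed

lemma sum_alternating_sample:
  "(\<Sum>n\<in>{1..2 * j}. g (if even n then q else p)) = of_nat j * (g p + g q :: real)"
  by (induction j) (auto simp: algebra_simps)

text \<open>One arbitrary observation among \<open>2 * j + 1\<close> changes the cdf by at most
  \<open>1 / (2 * j + 1)\<close> wherever it lies, so \<open>y j\<close> may run off to
  infinity.\<close>

lemma weak_conv_contaminated_alternating_sample:
  "weak_conv (\<lambda>j. empirical_cdf (2 * j + 1) ((\<lambda>n. if even n then q else p)(2 * j + 1 := y j)))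
     (empirical_cdf 2 (\<lambda>n. if even n then q else p))"
  unfolding weak_conv_def
proof (intro allI impI)
  fix t
  let ?s = "\<lambda>n::nat. if even n then q else p"
  define c :: real where "c = of_bool (p \<le> t) + of_bool (q \<le> t)"
  have limit: "empirical_cdf 2 ?s t = c / 2"
    using sum_alternating_sample[of "\<lambda>z. of_bool (z \<le> t)" q p 1]
    by (simp add: empirical_cdf_eq_sum c_def)
  have approx: "empirical_cdf (2 * j + 1) (?s(2 * j + 1 := y j)) t
      = (real j * c + of_bool (y j \<le> t)) / real (2 * j + 1)" for j
  proof -
    have "(\<Sum>n\<in>{1..2 * j}. of_bool ((?s(2 * j + 1 := y j)) n \<le> t)) = (\<Sum>n\<in>{1..2 * j}. of_bool (?s n \<le> t) :: real)"
      by (intro sum.cong) auto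
    also have "\<dots> = real j * c"
      using sum_alternating_sample[of "\<lambda>z. of_bool (z \<le> t)" q p j] by (simp add: c_def)
    finally show ?thesis
      by (simp add: empirical_cdf_eq_sum del: fun_upd_apply add: fun_upd_same)
  qed
  have "\<bar>empirical_cdf (2 * j + 1) (?s(2 * j + 1 := y j)) t - c / 2\<bar> \<le> 1 / real (Suc j)" for j
  proof -
    define r :: real where "r = of_bool (y j \<le> t)"
    \<comment> \<open>Both \<open>r\<close> and \<open>c / 2\<close> lie between 0 and 1, which
      bounds the numerator by 1.\<close>
    have "(real j * c + r) / real (2 * j + 1) - c / 2 = (r - c / 2) / real (2 * j + 1)"
      by (simp add: field_simps)
    moreover have "\<bar>r - c / 2\<bar> \<le> 1" by (simp add: r_def c_def)
    ultimately have "\<bar>(real j * c + r) / real (2 * j + 1) - c / 2\<bar> \<le> 1 / real (2 * j + 1)"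
      by (simp add: divide_right_mono)
    also have "\<dots> \<le> 1 / real (Suc j)" by (intro divide_left_mono) auto
    finally show ?thesis unfolding approx r_def .
  qed
  then have "(\<lambda>j. empirical_cdf (2 * j + 1) (?s(2 * j + 1 := y j)) t - c / 2) \<longlonglongrightarrow> 0"
    by (intro Lim_null_comparison[OF _ LIMSEQ_inverse_real_of_nat])
      (auto simp: inverse_eq_divide simp del: of_nat_Suc)
  then show "(\<lambda>j. empirical_cdf (2 * j + 1) (?s(2 * j + 1 := y j)) t) \<longlonglongrightarrow> empirical_cdf 2 ?s t"
    unfolding limit by (rule LIM_zero_cancel)
qed

section \<open>Likelihood, divergence and DR-expectation in terms of the cost\<close>

text \<open>A nonempty index set excludes the value \<open>- \<infinity>\<close>, so not being real
  means being \<open>\<infinity>\<close>.\<close>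

lemma SUP_ereal_notin_range_iff:
  fixes f :: "'a \<Rightarrow> real"
  assumes "A \<noteq> {}"
  shows "(SUP a\<in>A. ereal (f a)) \<notin> range ereal \<longleftrightarrow> (\<forall>K. \<exists>a\<in>A. K < f a)"
proof
  assume notin: "(SUP a\<in>A. ereal (f a)) \<notin> range ereal"
  show "\<forall>K. \<exists>a\<in>A. K < f a"
  proof (rule ccontr)
    assume "\<not> (\<forall>K. \<exists>a\<in>A. K < f a)"
    then obtain K where "\<And>a. a \<in> A \<Longrightarrow> f a \<le> K" by (auto simp: not_less)
    then have "(SUP a\<in>A. ereal (f a)) \<le> ereal K" by (intro SUP_least) simp
    moreover obtain a where "a \<in> A" using assms by blast
    then have "ereal (f a) \<le> (SUP a\<in>A. ereal (f a))" by (rule SUP_upper)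
    ultimately show False using notin by (cases "SUP a\<in>A. ereal (f a)") auto
  qed
next
  assume unbdd: "\<forall>K. \<exists>a\<in>A. K < f a"
  show "(SUP a\<in>A. ereal (f a)) \<notin> range ereal"
  proof
    assume "(SUP a\<in>A. ereal (f a)) \<in> range ereal"
    then obtain r where r: "(SUP a\<in>A. ereal (f a)) = ereal r" by blast
    obtain a where "a \<in> A" "r < f a" using unbdd by blast
    then show False using SUP_upper[of a A "\<lambda>a. ereal (f a)"] r by simp
  qed
qed

lemma likelihood_eq_exp: "likelihood \<Psi> X N x Q = exp (- shift_sum \<Psi> N x (loc X Q))"
  by (simp add: likelihood_def joint_density_def shift_sum_def exp_sum flip: sum_negf)

text \<open>The locations of the family exhaust the reals, so comparing measures amounts to
  comparing all real locations.\<close>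

lemma is_mle_iff_minimizes_cost:
  assumes "location_family \<Psi> X \<Q>"
  shows "is_mle \<Psi> X \<Q> N x m \<longleftrightarrow> minimizes_cost \<Psi> N x m"
proof -
  have surj: "loc X ` \<Q> = UNIV" using assms by (simp add: location_family_def bij_betw_def)
  have "(\<forall>Q'\<in>\<Q>. likelihood \<Psi> X N x Q' \<le> likelihood \<Psi> X N x Q)
      \<longleftrightarrow> (\<forall>m'\<in>loc X ` \<Q>. shift_sum \<Psi> N x (loc X Q) \<le> shift_sum \<Psi> N x m')" for Q
    by (auto simp: likelihood_eq_exp)
  then have "is_mle \<Psi> X \<Q> N x m \<longleftrightarrow> (\<exists>Q\<in>\<Q>. loc X Q = m \<and> minimizes_cost \<Psi> N x m)"
    unfolding is_mle_def surj minimizes_cost_def by auto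
  moreover obtain Q where "Q \<in> \<Q>" "loc X Q = m"
    using surj by (metis UNIV_I imageE)
  ultimately show ?thesis by blast
qed

text \<open>By independence the observations contribute a constant positive factor \<open>c\<close>
  to the joint density, which cancels and leaves the unconditional mean.\<close>

lemma cond_mean_linear:
  assumes "location_family \<Psi> X \<Q>" "Q \<in> \<Q>"
  shows "cond_mean \<Psi> X N x Q (\<lambda>y. \<beta> * y) = \<beta> * loc X Q"
proof -
  define m where "m = loc X Q"
  let ?d = "\<lambda>y. exp (- \<Psi> (y - m))"
  interpret prob_space Q using assms by (auto simp: location_family_def)
  have dist: "distributed Q lborel (X 0) ?d"
    using assms by (auto simp: location_family_def m_def)
  have mean: "(\<integral>y. ?d y * y \<partial>lborel) = m"
    using distributed_integral[OF dist, of "\<lambda>y. y"] by (simp add: m_def loc_def)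
  have total: "(\<integral>y. ?d y \<partial>lborel) = 1"
    using distributed_integral[OF dist, of "\<lambda>y. 1"] by (simp add: prob_space)
  define c where "c = likelihood \<Psi> X N x Q"
  have "c > 0" by (simp add: c_def likelihood_eq_exp)
  have split: "{0..N} = insert 0 {1..N}" by auto
  have joint: "joint_density \<Psi> X Q {0..N} (x(0 := y)) = ?d y * c" for y
    unfolding split c_def likelihood_def joint_density_def m_def by (subst prod.insert) auto
  have "(\<integral>y. \<beta> * y * (?d y * c) \<partial>lborel) = (\<integral>y. (\<beta> * c) * (?d y * y) \<partial>lborel)"
    by (intro Bochner_Integration.integral_cong) (auto simp: algebra_simps)
  also have "\<dots> = \<beta> * c * m" by (simp only: integral_mult_right_zero mean)
  finally show ?thesis
    using \<open>c > 0\<close> by (simp add: cond_mean_def joint total[unfolded m_def] m_def)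
qed

text \<open>The supremum of the log-likelihood is attained at the measure with location
  \<open>m\<^sub>0\<close>.\<close>

lemma divergence_eq:
  assumes family: "location_family \<Psi> X \<Q>" and min: "minimizes_cost \<Psi> N x m\<^sub>0"
  shows "divergence \<Psi> X \<Q> N x Q = ereal (shift_sum \<Psi> N x (loc X Q) - shift_sum \<Psi> N x m\<^sub>0)"
proof -
  have "(SUP Q'\<in>\<Q>. ereal (ln (likelihood \<Psi> X N x Q'))) = ereal (- shift_sum \<Psi> N x m\<^sub>0)"
  proof (rule antisym)
    show "(SUP Q'\<in>\<Q>. ereal (ln (likelihood \<Psi> X N x Q'))) \<le> ereal (- shift_sum \<Psi> N x m\<^sub>0)"
      using min by (intro SUP_least) (simp add: likelihood_eq_exp minimizes_cost_def)
    obtain Q' where "Q' \<in> \<Q>" "loc X Q' = m\<^sub>0"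
      using family by (metis UNIV_I bij_betw_def imageE location_family_def)
    then show "ereal (- shift_sum \<Psi> N x m\<^sub>0) \<le> (SUP Q'\<in>\<Q>. ereal (ln (likelihood \<Psi> X N x Q')))"
      by (intro SUP_upper2[of Q']) (auto simp: likelihood_eq_exp)
  qed
  then show ?thesis by (simp add: divergence_def likelihood_eq_exp)
qed

text \<open>The minimal cost enters only as an additive constant, absorbed by the quantifier over
  \<open>K\<close>.\<close>

lemma DR_expectation_notin_range_iff:
  assumes family: "location_family \<Psi> X \<Q>" and min: "minimizes_cost \<Psi> N x m\<^sub>0"
  shows "DR_expectation \<Psi> X \<Q> k N x (\<lambda>y. \<beta> * y) \<notin> range ereal
    \<longleftrightarrow> (\<forall>K. \<exists>m. K < \<beta> * m - shift_sum \<Psi> N x m / k)"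
proof -
  let ?L = "shift_sum \<Psi> N x"
  have surj: "loc X ` \<Q> = UNIV" using family by (simp add: location_family_def bij_betw_def)
  have "DR_expectation \<Psi> X \<Q> k N x (\<lambda>y. \<beta> * y)
      = (SUP Q\<in>\<Q>. ereal (\<beta> * loc X Q - (?L (loc X Q) - ?L m\<^sub>0) / k))"
    unfolding DR_expectation_def
    by (intro SUP_cong) (simp_all add: cond_mean_linear[OF family] divergence_eq[OF family min])
  then have DR: "DR_expectation \<Psi> X \<Q> k N x (\<lambda>y. \<beta> * y)
      = (SUP m. ereal (\<beta> * m - (?L m - ?L m\<^sub>0) / k))"
    by (simp add: image_comp flip: surj)
  have shift: "K < \<beta> * m - (?L m - ?L m\<^sub>0) / k \<longleftrightarrow> K - ?L m\<^sub>0 / k < \<beta> * m - ?L m / k" for K m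
    unfolding diff_divide_distrib by linarith
  have "(\<forall>K. \<exists>m\<in>UNIV. K - ?L m\<^sub>0 / k < \<beta> * m - ?L m / k) \<longleftrightarrow> (\<forall>K. \<exists>m. K < \<beta> * m - ?L m / k)"
  proof
    assume unbdd: "\<forall>K. \<exists>m\<in>UNIV. K - ?L m\<^sub>0 / k < \<beta> * m - ?L m / k"
    have "\<exists>m. (K + ?L m\<^sub>0 / k) - ?L m\<^sub>0 / k < \<beta> * m - ?L m / k" for K
      using unbdd by blast
    then show "\<forall>K. \<exists>m. K < \<beta> * m - ?L m / k" by simp
  qed blast
  then show ?thesis
    unfolding DR SUP_ereal_notin_range_iff[OF UNIV_not_empty] shift .
qed

section \<open>Each property compared with boundedness of \<open>\<psi>\<close>\<close>

lemma (in score_loss) positive_breakdown_point_iff_bounded: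
  assumes family: "location_family \<Psi> X \<Q>"
  shows "positive_breakdown_point \<Psi> X \<Q> \<longleftrightarrow> bounded (range \<psi>)"
proof
  assume "bounded (range \<psi>)"
  then show "positive_breakdown_point \<Psi> X \<Q>"
    unfolding positive_breakdown_point_def is_mle_iff_minimizes_cost[OF family]
    by (rule bounded_imp_breakdown) blast
next
  assume "positive_breakdown_point \<Psi> X \<Q>"
  then obtain \<delta> where "\<delta> > 0"
    and \<delta>: "\<forall>N\<ge>1. \<forall>x. \<forall>M\<subseteq>{1..N}. real (card M) < \<delta> * real N \<longrightarrow>
      (\<exists>B. \<forall>y m. minimizes_cost \<Psi> N (\<lambda>n. if n \<in> M then y n else x n) m \<longrightarrow> \<bar>m\<bar> \<le> B)"
    unfolding positive_breakdown_point_def is_mle_iff_minimizes_cost[OF family]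
    by (elim exE conjE)
  \<comment> \<open>Such a sample is so large that replacing a single observation stays below the
    fraction \<open>\<delta>\<close>.\<close>
  obtain N where "1 / \<delta> < real N" using reals_Archimedean2 by blast
  then have "1 < \<delta> * real N" using \<open>\<delta> > 0\<close> by (simp add: field_simps)
  moreover from this have "N \<ge> 1" by (cases N) auto
  ultimately obtain B where
    B: "\<forall>y m. minimizes_cost \<Psi> N (\<lambda>n. if n \<in> {1} then y n else 0) m \<longrightarrow> \<bar>m\<bar> \<le> B"
    using \<delta>[rule_format, of N "{1}" "\<lambda>_. 0"] by force
  show "bounded (range \<psi>)"
  proof (rule ccontr)
    assume "\<not> bounded (range \<psi>)"
    then obtain y m where ym: "minimizes_cost \<Psi> N ((\<lambda>_. 0)(1 := y)) m" "B + 1 \<le> \<bar>m\<bar>"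
      using unbounded_imp_large_minimizer[of 1 N "\<lambda>_. 0" "B + 1"] \<open>N \<ge> 1\<close> by auto
    have update: "(\<lambda>n. if n \<in> {1} then y else 0) = (\<lambda>_. 0)(1 := y)" by auto
    have "\<bar>m\<bar> \<le> B" using B[rule_format, of "\<lambda>_. y" m, unfolded update] ym(1) by blast
    then show False using ym(2) by simp
  qed
qed

lemma (in score_loss) mle_weakly_continuous_iff_bounded:
  assumes family: "location_family \<Psi> X \<Q>"
  shows "mle_weakly_continuous \<Psi> X \<Q> \<longleftrightarrow> bounded (range \<psi>)"
proof
  assume bounded: "bounded (range \<psi>)"
  show "mle_weakly_continuous \<Psi> X \<Q>"
    unfolding mle_weakly_continuous_def is_mle_iff_minimizes_cost[OF family]
  proof (intro allI impI, elim conjE)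
    fix N\<^sub>0 x\<^sub>0 m\<^sub>0 and N :: "nat \<Rightarrow> nat" and x m
    assume "N\<^sub>0 \<ge> 1" "minimizes_cost \<Psi> N\<^sub>0 x\<^sub>0 m\<^sub>0" "\<forall>m'. minimizes_cost \<Psi> N\<^sub>0 x\<^sub>0 m' \<longrightarrow> m' = m\<^sub>0"
      and *: "\<forall>j. N j \<ge> 1 \<and> minimizes_cost \<Psi> (N j) (x j) (m j)"
      and weak: "weak_conv (\<lambda>j. empirical_cdf (N j) (x j)) (empirical_cdf N\<^sub>0 x\<^sub>0)"
    then show "m \<longlonglongrightarrow> m\<^sub>0"
      using weak_conv_empirical_cdf_imp_averages_tendsto[OF _ _ weak]
      by (intro bounded_imp_minimizer_tendsto[OF bounded, of N\<^sub>0 x\<^sub>0 m\<^sub>0 N x m]) blast+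
  qed
next
  assume continuous: "mle_weakly_continuous \<Psi> X \<Q>"
  show "bounded (range \<psi>)"
  proof (rule ccontr)
    assume unbdd: "\<not> bounded (range \<psi>)"
    obtain p q where neg: "\<And>t. t > 0 \<Longrightarrow> \<psi> (p - t) + \<psi> (q - t) < 0"
      and pos: "\<And>t. t < 0 \<Longrightarrow> 0 < \<psi> (p - t) + \<psi> (q - t)"
      by (rule two_point_score_sign) blast
    \<comment> \<open>The first \<open>2 * j\<close> values consist of \<open>j\<close> copies each
      of \<open>p\<close> and \<open>q\<close>, so one function provides the limiting sample and all
      its repetitions.\<close>
    define s where "s n = (if even n then q else p)" for n :: nat
    have score: "shift_sum \<psi> 2 s t = \<psi> (p - t) + \<psi> (q - t)" for t
      by (simp add: shift_sum_def s_def numeral_2_eq_2)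
    have min0: "minimizes_cost \<Psi> 2 s 0"
      using neg pos by (auto simp: minimizes_cost_iff_score_sign score less_imp_le)
    have unique: "m' = 0" if "minimizes_cost \<Psi> 2 s m'" for m'
    proof -
      \<comment> \<open>The strict sign at \<open>m' / 2\<close> would confine \<open>m'\<close> to
        the side of \<open>m' / 2\<close> nearer 0.\<close>
      have "\<not> m' > 0" using minimizer_le[OF that, of "m' / 2"] neg[of "m' / 2"] by (auto simp: score)
      moreover have "\<not> m' < 0" using minimizer_ge[OF that, of "m' / 2"] pos[of "m' / 2"] by (auto simp: score)
      ultimately show ?thesis by simp
    qed
    \<comment> \<open>The additional last observation drives a minimizer at least distance 1 from
      the limiting minimizer 0.\<close>
    have "\<exists>y m. minimizes_cost \<Psi> (2 * j + 1) (s(2 * j + 1 := y)) m \<and> 1 \<le> \<bar>m\<bar>" for j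
      by (rule unbounded_imp_large_minimizer[OF unbdd, of "2 * j + 1" "2 * j + 1" s 1]) auto
    then obtain y m where ym: "\<And>j. minimizes_cost \<Psi> (2 * j + 1) (s(2 * j + 1 := y j)) (m j)"
      "\<And>j. 1 \<le> \<bar>m j\<bar>" by metis
    have "weak_conv (\<lambda>j. empirical_cdf (2 * j + 1) (s(2 * j + 1 := y j))) (empirical_cdf 2 s)"
      unfolding s_def[abs_def] by (rule weak_conv_contaminated_alternating_sample)
    then have "m \<longlonglongrightarrow> 0"
      using continuous[unfolded mle_weakly_continuous_def is_mle_iff_minimizes_cost[OF family], rule_format,
          of 2 s 0 "\<lambda>j. 2 * j + 1" "\<lambda>j. s(2 * j + 1 := y j)" m] min0 unique ym(1)
      by (simp del: fun_upd_apply)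
    then obtain j where "\<bar>m j\<bar> < 1"
      using LIMSEQ_D[of m 0 1] by auto
    then show False using ym(2)[of j] by simp
  qed
qed

lemma (in score_loss) DR_expectation_infinite_for_large_iff_bounded:
  assumes family: "location_family \<Psi> X \<Q>"
  shows "DR_expectation_infinite_for_large \<Psi> X \<Q> \<longleftrightarrow> bounded (range \<psi>)"
proof
  assume "bounded (range \<psi>)"
  then obtain C where C: "\<And>z. \<bar>\<psi> z\<bar> \<le> C" by (auto simp: bounded_iff)
  show "DR_expectation_infinite_for_large \<Psi> X \<Q>"
    unfolding DR_expectation_infinite_for_large_def
  proof (intro allI impI)
    fix k :: real and N x assume "k > 0" and N: "(N::nat) \<ge> 1"
    obtain m\<^sub>0 where min: "minimizes_cost \<Psi> N x m\<^sub>0" using minimizer_exists[OF N] .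
    show "\<exists>B. \<forall>\<beta>. B \<le> \<bar>\<beta>\<bar> \<longrightarrow> DR_expectation \<Psi> X \<Q> k N x (\<lambda>y. \<beta> * y) \<notin> range ereal"
      unfolding DR_expectation_notin_range_iff[OF family min]
      using bounded_imp_linear_minus_cost_unbounded[OF C \<open>k > 0\<close>]
      by (intro exI[of _ "real N * C / k + 1"]) auto
  qed
next
  assume DR: "DR_expectation_infinite_for_large \<Psi> X \<Q>"
  obtain m\<^sub>0 where min: "minimizes_cost \<Psi> 1 (\<lambda>_. 0) m\<^sub>0" using minimizer_exists[of 1] by auto
  \<comment> \<open>With \<open>k = 1\<close> and one observation at 0 the cost is
    \<open>\<Psi> (- m)\<close>, the form treated for unbounded \<open>\<psi>\<close>.\<close>
  have "\<exists>B. \<forall>\<beta>. B \<le> \<bar>\<beta>\<bar> \<longrightarrow> (\<forall>K. \<exists>m. K < \<beta> * m - shift_sum \<Psi> 1 (\<lambda>_. 0) m / 1)"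
    using DR unfolding DR_expectation_infinite_for_large_def
    by (simp only: zero_less_one order_refl simp_thms flip: DR_expectation_notin_range_iff[OF family min])
  then obtain B where B: "\<And>\<beta> K. B \<le> \<bar>\<beta>\<bar> \<Longrightarrow> \<exists>m. K < \<beta> * m - \<Psi> (- m)"
    by (auto simp: shift_sum_def)
  show "bounded (range \<psi>)"
  proof (rule ccontr)
    assume "\<not> bounded (range \<psi>)"
    then obtain \<beta> K where "B \<le> \<bar>\<beta>\<bar>" "\<And>m. \<beta> * m - \<Psi> (- m) \<le> K"
      by (rule unbounded_imp_linear_minus_cost_bdd) blast
    then show False using B[of \<beta> K] by (meson leD)
  qed
qed

theorem theorem8:
  fixes \<Psi> \<psi> :: "real \<Rightarrow> real"
    and X :: "nat \<Rightarrow> 'w \<Rightarrow> real"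
    and \<Q> :: "'w measure set"
    and l u :: ereal
  assumes "location_family \<Psi> X \<Q>"
    and "monotone_derivative \<Psi> \<psi>"
    and "((\<lambda>x. ereal (\<psi> x)) \<longlongrightarrow> l) at_bot" and "l < 0"
    and "((\<lambda>x. ereal (\<psi> x)) \<longlongrightarrow> u) at_top" and "0 < u"
  shows "(\<forall>N\<ge>1. \<forall>x m. is_mle \<Psi> X \<Q> N x m \<longleftrightarrow> solves_score_equation \<psi> N x m)
    \<and> (positive_breakdown_point \<Psi> X \<Q> \<longleftrightarrow> mle_weakly_continuous \<Psi> X \<Q>)
    \<and> (mle_weakly_continuous \<Psi> X \<Q> \<longleftrightarrow> bounded (range \<psi>))
    \<and> (bounded (range \<psi>) \<longleftrightarrow> DR_expectation_infinite_for_large \<Psi> X \<Q>)"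
proof -
  interpret score_loss \<Psi> \<psi>
  proof
    show "mono \<psi>" "continuous_on UNIV \<Psi>"
      using assms(2) by (auto simp: monotone_derivative_def)
    show "\<Psi> x + \<psi> x * (y - x) \<le> \<Psi> y" for x y
      by (rule monotone_derivative_subgradient[OF assms(2)])
    \<comment> \<open>The strict signs of the limits hold eventually, hence at some point, as both
      filters are nontrivial.\<close>
    have "\<forall>\<^sub>F x in at_bot. ereal (\<psi> x) < 0" "\<forall>\<^sub>F x in at_top. 0 < ereal (\<psi> x)"
      using order_tendstoD(2)[OF assms(3,4)] order_tendstoD(1)[OF assms(5,6)] .
    then show "\<exists>a. \<psi> a < 0" "\<exists>b. \<psi> b > 0"
      by (auto dest!: eventually_happens simp: trivial_limit_at_bot_linorder trivial_limit_at_top_linorder)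
  qed
  show ?thesis
    using positive_breakdown_point_iff_bounded[OF assms(1)]
      mle_weakly_continuous_iff_bounded[OF assms(1)]
      DR_expectation_infinite_for_large_iff_bounded[OF assms(1)]
    by (simp add: is_mle_iff_minimizes_cost[OF assms(1)] minimizes_cost_iff_solves_score_equation)
qed

end
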